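(* Let $n\ge2$ be an integer, $\lambda=\frac{n-1}{2}$, $a>0$, $r=e^{-a}$. For every $m\in\mathbb N=\{1,2,\dots\}$ the Poisson wavelet $g_a^m$ on $\mathcal S^n$ is represented, for $y\in\mathcal S^n$ with $\cos\theta=\hat e\cdot y$, by $$g_a^m(y)=\frac{a^m}{\Sigma_n}\,D_{\lambda+m+1}\sum_{k=0}^mR_k^{m}(r)\cos^k\theta,\qquad D_j=D_j(r,\theta)=\frac{r}{(1-2r\cos\theta+r^2)^j},$$ where $R_k^m$ are polynomials of degree $2m-k+1$, explicitly given by $$R_k^{m}(r)=\sum_{j=0}^{[(2m-k+1)/2]}a_j^{m,k}\,r^{2j+\epsilon_k},$$ with $\epsilon_k=1$ for even $k$ and $\epsilon_k=0$ for odd $k$, and the coefficients $a_j^{m,k}$ are determined by the initial values $$a_0^{1,0}=-(n+3),\quad a_1^{1,0}=n-1,\quad a_0^{1,1}=n+1,\quad a_1^{1,1}=-(n-3)$$ and, for $m\ge1$, the recursion \begin{align*} a_j^{m+1,0}&=b_j^{m+1,0}, && j=0,\dots,m+1,\\ a_j^{m+1,k}&=b_j^{m+1,k}+c_j^{m+1,k}, && k=1,\dots,m,\ j=0,\dots,m+1-[k/2],\\ a_j^{m+1,m+1}&=c_j^{m+1,m+1}, && j=0,\dots,m+1-[(m+1)/2], \end{align*} where, for even $k$, \begin{align*} b_0^{m+1,k}&=2\,a_0^{m,k},\\ b_j^{m+1,k}&=2(j+1)\,a_j^{m,k}+2(j-\lambda-m-1)\,a_{j-1}^{m,k},\quad j=1,\dots,m-k/2,\\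 b_{m+1-k/2}^{m+1,k}&=-(2\lambda+k)\,a_{m-k/2}^{m,k},\\ c_0^{m+1,k}&=2(\lambda+m)\,a_0^{m,k-1},\\ c_j^{m+1,k}&=2(\lambda+m-2j)\,a_j^{m,k-1},\quad j=1,\dots,m+1-k/2, \end{align*} and, for odd $k$, \begin{align*} b_0^{m+1,k}&=a_0^{m,k},\\ b_j^{m+1,k}&=(2j+1)\,a_j^{m,k}+\left(2(j-\lambda-m)-3\right)a_{j-1}^{m,k},\quad j=1,\dots,m-[k/2],\\ b_{m+1-[k/2]}^{m+1,k}&=-(2\lambda+k)\,a_{m-[k/2]}^{m,k},\\ c_0^{m+1,k}&=0,\\ c_j^{m+1,k}&=2(\lambda+m-2j+1)\,a_{j-1}^{m,k-1},\quad j=1,\dots,m+1-[k/2]. \end{align*} Here the $b$'s are defined for $0\le k\le m$ and the $c$'s for $1\le k\le m+1$.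
   Context: $[\cdot]$ denotes the integer part. $\mathcal S^n$ is the unit sphere in $\mathbb R^{n+1}$, $\hat e=(1,0,\dots,0)$ its north pole, and $\Sigma_n=\frac{2\pi^{\lambda+1}}{\Gamma(\lambda+1)}$ its surface measure. Poisson kernel: for $0\le r<1$ and $y\in\mathcal S^n$ with $\cos\theta=\hat e\cdot y$, $$p_{r\hat e}(y)=\frac{1}{\Sigma_n}\frac{1-r^2}{(1-2r\cos\theta+r^2)^{(n+1)/2}}.$$ The Poisson wavelet of order $m\in\mathbb N$ at scale $a>0$ is the function on $\mathcal S^n$ $$g_a^m(y)=a^m\left[(r\partial_r)^m p_{r\hat e}(y)\right]_{r=e^{-a}}.$$
   Formalization: "Of degree 2m-k+1" is proved as degree at most 2m-k+1, with equality whenever the top coefficient a_j^{m,k}, j=[(2m-k+1)/2], is nonzero; exact degree fails for n=3, m=k=1, where a_1^{1,1}=0 and R_1^1=4. *)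

theory Defs
  imports "HOL-Analysis.Analysis" "HOL-Computational_Algebra.Polynomial"
begin

(* The space R^(n+1) is rendered as real \<times> real^'n with n = CARD('n), so that the first
   coordinate is singled out; its library norm and inner product are the Euclidean ones.
   The sphere S^n is sphere 0 1 in this type. *)

definition north_pole :: "real \<times> (real ^ 'n)" where
  "north_pole = (1, 0)"

definition lam :: "nat \<Rightarrow> real" where
  "lam n = (real n - 1) / 2"

definition sphere_area :: "nat \<Rightarrow> real" where
  "sphere_area n = 2 * pi powr (lam n + 1) / Gamma (lam n + 1)"

(* Meant for 0 \<le> r < 1 and y on the unit sphere, where the base of the power is positive. *)
definition poisson_kernel :: "real \<Rightarrow> real \<times> (real ^ 'n) \<Rightarrow> real" where
  "poisson_kernel r y =
     1 / sphere_area CARD('n) *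
     ((1 - r\<^sup>2) / (1 - 2 * r * (north_pole \<bullet> y) + r\<^sup>2) powr ((real CARD('n) + 1) / 2))"

definition euler_op :: "(real \<Rightarrow> real) \<Rightarrow> real \<Rightarrow> real" where
  "euler_op f = (\<lambda>r. r * deriv f r)"

definition poisson_wavelet :: "nat \<Rightarrow> real \<Rightarrow> real \<times> (real ^ 'n) \<Rightarrow> real" where
  "poisson_wavelet m a y = a ^ m * (euler_op ^^ m) (\<lambda>r. poisson_kernel r y) (exp (- a))"

definition Dfun :: "real \<Rightarrow> real \<Rightarrow> real \<Rightarrow> real" where
  "Dfun j r \<theta> = r / (1 - 2 * r * cos \<theta> + r\<^sup>2) powr j"

(* In b_next and c_next the argument A is the family of coefficients of order m, that is,
   A k j = a_j^{m,k}; the results are b_j^{m+1,k} and c_j^{m+1,k}. Outside the index ranges of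
   the recursion (0 \<le> k \<le> m for b, 1 \<le> k \<le> m + 1 for c, and the given ranges of j)
   the values are irrelevant. *)

definition b_next :: "nat \<Rightarrow> nat \<Rightarrow> (nat \<Rightarrow> nat \<Rightarrow> real) \<Rightarrow> nat \<Rightarrow> nat \<Rightarrow> real" where
  "b_next n m A k j =
    (if even k then
       (if j = 0 then 2 * A k 0
        else if j \<le> m - k div 2 then
          2 * (real j + 1) * A k j + 2 * (real j - lam n - real m - 1) * A k (j - 1)
        else if j = m + 1 - k div 2 then
          - (2 * lam n + real k) * A k (m - k div 2)
        else 0)
     else
       (if j = 0 then A k 0
        else if j \<le> m - k div 2 then
          (2 * real j + 1) * A k j + (2 * (real j - lam n - real m) - 3) * A k (j - 1)
        else if j = m + 1 - k div 2 then
          - (2 * lam n + real k) * A k (m - k div 2)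
        else 0))"

definition c_next :: "nat \<Rightarrow> nat \<Rightarrow> (nat \<Rightarrow> nat \<Rightarrow> real) \<Rightarrow> nat \<Rightarrow> nat \<Rightarrow> real" where
  "c_next n m A k j =
    (if even k then
       (if j = 0 then 2 * (lam n + real m) * A (k - 1) 0
        else if j \<le> m + 1 - k div 2 then
          2 * (lam n + real m - 2 * real j) * A (k - 1) j
        else 0)
     else
       (if j = 0 then 0
        else if j \<le> m + 1 - k div 2 then
          2 * (lam n + real m - 2 * real j + 1) * A (k - 1) (j - 1)
        else 0))"

(* acoeff n m k j is a_j^{m,k} for m \<ge> 1, 0 \<le> k \<le> m and 0 \<le> j \<le> (2m - k + 1) div 2;
   all other values are 0 and are never used. *)
fun acoeff :: "nat \<Rightarrow> nat \<Rightarrow> nat \<Rightarrow> nat \<Rightarrow> real" where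
  "acoeff n 0 k j = 0"
| "acoeff n (Suc 0) k j =
     (if k = 0 \<and> j = 0 then - (real n + 3)
      else if k = 0 \<and> j = 1 then real n - 1
      else if k = 1 \<and> j = 0 then real n + 1
      else if k = 1 \<and> j = 1 then - (real n - 3)
      else 0)"
| "acoeff n (Suc (Suc m')) k j =
     (let m = Suc m'; A = acoeff n m in
      if m + 1 - k div 2 < j then 0
      else if k = 0 then b_next n m A k j
      else if k \<le> m then b_next n m A k j + c_next n m A k j
      else if k = m + 1 then c_next n m A k j
      else 0)"

definition eps :: "nat \<Rightarrow> nat" where
  "eps k = (if even k then 1 else 0)"

definition Rpoly :: "nat \<Rightarrow> nat \<Rightarrow> nat \<Rightarrow> real poly" where
  "Rpoly n m k = (\<Sum>j = 0..(2 * m - k + 1) div 2. monom (acoeff n m k j) (2 * j + eps k))"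

end

theory Submission imports Defs begin

text \<open>
  Put \<open>t = cos \<theta>\<close> and \<open>B = 1 - 2 r t + r\<^sup>2\<close>. Since \<open>(n + 1) / 2 = \<lambda> + 1\<close>, the Poisson kernel is a
  constant times \<open>(1 - r\<^sup>2) B\<^sup>-\<^sup>\<lambda>\<^sup>-\<^sup>1\<close>, and one application of \<open>r \<partial>\<^sub>r\<close> brings it into the form
  \<open>r Q B\<^sup>-\<^sup>s\<close> with \<open>Q\<close> a polynomial in \<open>r\<close> and \<open>t\<close> and \<open>s = \<lambda> + 2\<close>. From then on the form reproduces
  itself:
  \<open>r \<partial>\<^sub>r (r Q B\<^sup>-\<^sup>s) = r B\<^sup>-\<^sup>s\<^sup>-\<^sup>1 (B \<partial>\<^sub>r(r Q) - 2 s r (r - t) Q)\<close>.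

  Sorting the last bracket by powers of \<open>t\<close> turns it into a recursion for the coefficients \<open>R\<^sub>k\<close> of
  \<open>Q\<close>, which is linear with polynomial coefficients in \<open>r\<close>: the part free of \<open>t\<close> keeps the index
  \<open>k\<close> and gives the \<open>b\<close>'s, the part with a factor \<open>t\<close> raises \<open>k\<close> by one and gives the \<open>c\<close>'s. What
  remains is to see that this is the prescribed recursion. Its case distinctions at the ends of the
  index ranges disappear once the coefficients outside these ranges are known to be zero
  (\<open>acoeff_eq_0\<close>): the extreme rows are then instances of the generic row
  (\<open>acoeff_Suc_even\<close>, \<open>acoeff_Suc_odd\<close>). The parity of \<open>k\<close> also becomes invisible when the rows are
  read as coefficients of \<open>R\<^sub>k\<close>, which contains only powers of \<open>r\<close> of parity opposite to that
  of \<open>k\<close> (\<open>coeff_Rpoly\<close>, \<open>Rpoly_Suc\<close>).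
\<close>

section \<open>The coefficient recursion without boundary cases\<close>

text \<open>The bound \<open>m - k div 2\<close> is the upper summation limit \<open>(2 * m - k + 1) div 2\<close> of \<open>Rpoly\<close>.\<close>

lemma acoeff_eq_0:
  assumes "k > m \<or> j > m - k div 2"
  shows "acoeff n m k j = 0"
proof (cases "(n, m, k, j)" rule: acoeff.cases)
  case (2 n k j)
  with assms show ?thesis by auto
qed (use assms in \<open>auto simp: Let_def c_next_def\<close>)

lemma acoeff_Suc:
  assumes "m \<ge> 1"
  shows "acoeff n (Suc m) k j =
     (if m + 1 - k div 2 < j then 0
      else if k = 0 then b_next n m (acoeff n m) k j
      else if k \<le> m then b_next n m (acoeff n m) k j + c_next n m (acoeff n m) k j
      else if k = m + 1 then c_next n m (acoeff n m) k j
      else 0)"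
  using assms by (cases m) (simp_all add: Let_def)

text \<open>In the top row of the recursion the factor of \<open>acoeff n m k (j - 1)\<close> is the generic one,
  because \<open>2 * (j - \<lambda> - m - 1) = - (2 * \<lambda> + k)\<close> for \<open>j = m + 1 - k div 2\<close>, and the other
  summand contains \<open>acoeff n m k j = 0\<close>. For odd \<open>k\<close> the same index gives
  \<open>2 * (j - \<lambda> - m) - 3 = - (2 * \<lambda> + k)\<close>.\<close>

lemma acoeff_Suc_even:
  assumes "m \<ge> 1" and "even k"
  shows "acoeff n (Suc m) k j =
           2 * (real j + 1) * acoeff n m k j
         + (if j = 0 then 0 else 2 * (real j - lam n - real m - 1) * acoeff n m k (j - 1))
         + (if k = 0 then 0 else 2 * (lam n + real m - 2 * real j) * acoeff n m (k - 1) j)"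
    (is "_ = ?b + ?b' + ?c")
proof -
  obtain l where k: "k = 2 * l" using assms by (elim evenE)
  have half: "(k - 1) div 2 = l - 1" by (simp add: k)
  have b: "b_next n m (acoeff n m) k j = ?b + ?b'" if "k \<le> m" "j \<le> m + 1 - l"
  proof (cases "j = m + 1 - l")
    case True
    moreover from this have "real j = real m + 1 - real l" using that k by (simp add: of_nat_diff)
    moreover have "acoeff n m k j = 0" using True k that by (intro acoeff_eq_0) auto
    ultimately show ?thesis using k that
      by (auto simp: b_next_def Suc_diff_le algebra_simps)
  next
    case False
    then have "j \<le> m - l" using that k by auto
    then show ?thesis using k by (auto simp: b_next_def)
  qed
  have c: "c_next n m (acoeff n m) k j = ?c" if "k > 0" "j \<le> m + 1 - l"
    using that k by (auto simp: c_next_def)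
  show ?thesis
  proof (cases "j > m + 1 - l \<or> k > m + 1")
    case True
    then have "acoeff n m k j = 0" "j > 0 \<Longrightarrow> acoeff n m k (j - 1) = 0"
      "k > 0 \<Longrightarrow> acoeff n m (k - 1) j = 0"
      using k half by (auto intro!: acoeff_eq_0)
    with True k show ?thesis by (auto simp: acoeff_Suc[OF assms(1)])
  next
    case False
    have "acoeff n m k i = 0" if "k > m" for i using that by (intro acoeff_eq_0) auto
    with False b c k show ?thesis by (auto simp: acoeff_Suc[OF assms(1)])
  qed
qed

lemma acoeff_Suc_odd:
  assumes "m \<ge> 1" and "odd k"
  shows "acoeff n (Suc m) k j =
           (2 * real j + 1) * acoeff n m k j
         + (if j = 0 then 0 else (2 * (real j - lam n - real m) - 3) * acoeff n m k (j - 1))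
         + (if j = 0 then 0
            else 2 * (lam n + real m - 2 * real j + 1) * acoeff n m (k - 1) (j - 1))"
    (is "_ = ?b + ?b' + ?c")
proof -
  obtain l where k: "k = 2 * l + 1" using assms by (elim oddE)
  have half: "k div 2 = l" by (simp add: k)
  have b: "b_next n m (acoeff n m) k j = ?b + ?b'" if "k \<le> m" "j \<le> m + 1 - l"
  proof (cases "j = m + 1 - l")
    case True
    moreover from this have "real j = real m + 1 - real l" using that k by (simp add: of_nat_diff)
    moreover have "acoeff n m k j = 0" using True k that by (intro acoeff_eq_0) auto
    ultimately show ?thesis using k that
      by (auto simp: b_next_def Suc_diff_le algebra_simps)
  next
    case False
    then have "j \<le> m - l" using that k by auto
    then show ?thesis using k by (auto simp: b_next_def)
  qed
  have c: "c_next n m (acoeff n m) k j = ?c" if "j \<le> m + 1 - l"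
    using that k by (auto simp: c_next_def)
  show ?thesis
  proof (cases "j > m + 1 - l \<or> k > m + 1")
    case True
    then have "acoeff n m k j = 0" "j > 0 \<Longrightarrow> acoeff n m k (j - 1) = 0"
      "j > 0 \<Longrightarrow> acoeff n m (k - 1) (j - 1) = 0"
      using k by (auto intro!: acoeff_eq_0)
    with True half k show ?thesis by (auto simp: acoeff_Suc[OF assms(1)])
  next
    case False
    have "acoeff n m k i = 0" if "k > m" for i using that by (intro acoeff_eq_0) auto
    with False b c half k show ?thesis by (auto simp: acoeff_Suc[OF assms(1)])
  qed
qed

section \<open>The polynomials \<open>R\<^sub>k\<close>\<close>

text \<open>The exponent \<open>2 * j + eps k\<close> equals \<open>i\<close> exactly when \<open>i\<close> and \<open>k\<close> have opposite parity and
  \<open>j = i div 2\<close>. The summation limit leaves no trace, since the coefficients beyond it vanish.\<close>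

lemma coeff_Rpoly:
  "coeff (Rpoly n m k) i = (if odd (i + k) then acoeff n m k (i div 2) else 0)"
proof -
  have "coeff (Rpoly n m k) i =
      (\<Sum>j = 0..(2 * m - k + 1) div 2.
        if j = i div 2 then (if odd (i + k) then acoeff n m k j else 0) else 0)"
    unfolding Rpoly_def coeff_sum
    by (intro sum.cong refl) (auto simp: eps_def elim!: evenE oddE)
  also have "\<dots> = (if i div 2 \<le> (2 * m - k + 1) div 2
      then if odd (i + k) then acoeff n m k (i div 2) else 0 else 0)"
    by simp
  also have "\<dots> = (if odd (i + k) then acoeff n m k (i div 2) else 0)"
  proof -
    have "acoeff n m k (i div 2) = 0" if "\<not> i div 2 \<le> (2 * m - k + 1) div 2"
      using that by (intro acoeff_eq_0 disjI2) linarith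
    then show ?thesis by auto
  qed
  finally show ?thesis .
qed

lemma Rpoly_eq_0: "k > m \<Longrightarrow> Rpoly n m k = 0"
  by (rule poly_eqI) (simp add: coeff_Rpoly acoeff_eq_0)

lemma degree_Rpoly_le:
  assumes "k \<le> m"
  shows "degree (Rpoly n m k) \<le> 2 * m - k + 1"
proof (rule degree_le, intro allI impI)
  fix i assume i: "2 * m - k + 1 < i"
  show "coeff (Rpoly n m k) i = 0"
  proof (cases "odd (i + k)")
    case True
    then have "i div 2 > m - k div 2" using i assms by presburger
    then show ?thesis by (simp add: coeff_Rpoly acoeff_eq_0)
  qed (simp add: coeff_Rpoly)
qed

lemma degree_Rpoly_eq:
  assumes "k \<le> m" and "acoeff n m k ((2 * m - k + 1) div 2) \<noteq> 0"
  shows "degree (Rpoly n m k) = 2 * m - k + 1"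
proof (rule antisym[OF degree_Rpoly_le[OF assms(1)]])
  have "odd (2 * m - k + 1 + k)" using assms(1) by simp
  with assms(2) have "coeff (Rpoly n m k) (2 * m - k + 1) \<noteq> 0" by (simp add: coeff_Rpoly)
  then show "2 * m - k + 1 \<le> degree (Rpoly n m k)" by (rule le_degree)
qed

text \<open>This is the coefficient of \<open>t ^ k\<close> in \<open>B \<partial>\<^sub>r(r Q) - 2 s r (r - t) Q\<close>, where \<open>pCons 0\<close> is
  multiplication by \<open>r\<close>: the contribution of \<open>1 + r\<^sup>2\<close> and \<open>- 2 s r\<^sup>2\<close> comes from \<open>R\<^sub>k\<close>, that of
  \<open>- 2 r t\<close> and \<open>2 s r t\<close> from \<open>R\<^sub>k\<^sub>-\<^sub>1\<close>.\<close>

lemma Rpoly_Suc: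
  fixes n m k :: nat
  defines "s \<equiv> lam n + real m + 1" and "R \<equiv> Rpoly n m"
  assumes "m \<ge> 1"
  shows "Rpoly n (Suc m) k =
      [:1, 0, 1:] * pderiv (pCons 0 (R k)) - smult (2 * s) (pCons 0 (pCons 0 (R k)))
    + (if k = 0 then 0
       else smult (2 * s) (pCons 0 (R (k - 1)))
            - smult 2 (pCons 0 (pderiv (pCons 0 (R (k - 1))))))"
proof (rule poly_eqI)
  fix i
  show "coeff (Rpoly n (Suc m) k) i = coeff (
      [:1, 0, 1:] * pderiv (pCons 0 (R k)) - smult (2 * s) (pCons 0 (pCons 0 (R k)))
    + (if k = 0 then 0
       else smult (2 * s) (pCons 0 (R (k - 1)))
            - smult 2 (pCons 0 (pderiv (pCons 0 (R (k - 1))))))) i"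
  proof (cases "even k")
    case True
    show ?thesis
    proof (cases "odd i")
      case odd: True
      then obtain j where "i = 2 * j + 1" by (elim oddE)
      with True show ?thesis
        by (cases j; cases k)
          (auto simp: coeff_Rpoly R_def s_def acoeff_Suc_even[OF assms(3)] coeff_pderiv
            coeff_pCons algebra_simps split: nat.splits)
    next
      case False
      with True show ?thesis
        by (cases k) (auto simp: coeff_Rpoly R_def coeff_pderiv coeff_pCons split: nat.splits)
    qed
  next
    case False
    show ?thesis
    proof (cases "even i")
      case True
      then obtain j where "i = 2 * j" by (elim evenE)
      with False show ?thesis
        by (cases j; cases k)
          (auto simp: coeff_Rpoly R_def s_def acoeff_Suc_odd[OF assms(3)] coeff_pderiv
            coeff_pCons algebra_simps split: nat.splits)
    next
      case odd: False
      with False show ?thesis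
        by (cases k) (auto simp: coeff_Rpoly R_def coeff_pderiv coeff_pCons split: nat.splits)
    qed
  qed
qed

section \<open>The numerator as a polynomial in \<open>r\<close> and \<open>t\<close>\<close>

definition Qfun :: "nat \<Rightarrow> nat \<Rightarrow> real \<Rightarrow> real \<Rightarrow> real" where
  "Qfun n m t r = (\<Sum>k = 0..m. poly (Rpoly n m k) r * t ^ k)"

text \<open>The derivative of \<open>r Q\<close>, not of \<open>Q\<close>, with respect to \<open>r\<close>: the factor \<open>r\<close> of the numerator
  is differentiated along.\<close>

definition dQfun :: "nat \<Rightarrow> nat \<Rightarrow> real \<Rightarrow> real \<Rightarrow> real" where
  "dQfun n m t r = (\<Sum>k = 0..m. poly (pderiv (pCons 0 (Rpoly n m k))) r * t ^ k)"

lemma has_derivative_mult_Qfun: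
  "((\<lambda>x. x * Qfun n m t x) has_field_derivative dQfun n m t r) (at r)"
proof -
  have "(\<lambda>x. x * Qfun n m t x) = (\<lambda>x. \<Sum>k = 0..m. poly (pCons 0 (Rpoly n m k)) x * t ^ k)"
    by (simp add: Qfun_def sum_distrib_left mult.assoc)
  then show ?thesis unfolding dQfun_def
    by (simp only:) (intro DERIV_sum DERIV_cmult_right poly_DERIV)
qed

lemma Qfun_1:
  "Qfun n 1 t r = - (real n + 3) * r + (real n - 1) * r ^ 3 + (real n + 1 - (real n - 3) * r\<^sup>2) * t"
proof -
  have I: "{0..1::nat} = {0, 1}" by auto
  have "Rpoly n 1 0 = monom (- (real n + 3)) 1 + monom (real n - 1) 3"
    by (simp add: Rpoly_def eps_def I[simplified])
  moreover have "Rpoly n 1 1 = monom (real n + 1) 0 + monom (- (real n - 3)) 2"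
    by (simp add: Rpoly_def eps_def I[simplified])
  ultimately show ?thesis
    unfolding Qfun_def I by (simp add: poly_monom algebra_simps)
qed

lemma Qfun_Suc:
  assumes "m \<ge> 1"
  shows "Qfun n (Suc m) t r =
      (1 - 2 * r * t + r\<^sup>2) * dQfun n m t r - 2 * (lam n + real m + 1) * r * (r - t) * Qfun n m t r"
proof -
  define s where "s = lam n + real m + 1"
  define R where "R = (\<lambda>k. poly (Rpoly n m k) r)"
  define dR where "dR = (\<lambda>k. poly (pderiv (pCons 0 (Rpoly n m k))) r)"
  define G where "G = (\<lambda>k. (1 + r\<^sup>2) * dR k - 2 * s * r\<^sup>2 * R k)"
  define H where "H = (\<lambda>k. 2 * s * r * R k - 2 * r * dR k)"
  have step: "poly (Rpoly n (Suc m) k) r = G k + (if k = 0 then 0 else H (k - 1))" for k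
    by (simp add: Rpoly_Suc[OF assms] G_def H_def R_def dR_def s_def power2_eq_square algebra_simps)
  \<comment> \<open>The range of \<open>k\<close> grows by one with \<open>m\<close>, and only the shifted part reaches the new index.\<close>
  have top: "G (Suc m) = 0" by (simp add: G_def R_def dR_def Rpoly_eq_0)
  have "Qfun n (Suc m) t r =
      (\<Sum>k = 0..Suc m. G k * t ^ k) + (\<Sum>k = 0..Suc m. if k = 0 then 0 else H (k - 1) * t ^ k)"
    unfolding Qfun_def step sum.distrib[symmetric] by (intro sum.cong) (auto simp: distrib_right)
  also have "(\<Sum>k = 0..Suc m. if k = 0 then 0 else H (k - 1) * t ^ k) = (\<Sum>k = 0..m. H k * t ^ Suc k)"
    by (subst sum.atLeast0_atMost_Suc_shift) simp
  also have "(\<Sum>k = 0..Suc m. G k * t ^ k) = (\<Sum>k = 0..m. G k * t ^ k)"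
    using top by simp
  also have "(\<Sum>k = 0..m. G k * t ^ k) = (1 + r\<^sup>2) * dQfun n m t r - 2 * s * r\<^sup>2 * Qfun n m t r"
    unfolding G_def dQfun_def Qfun_def R_def dR_def sum_distrib_left
    by (simp add: sum_subtractf[symmetric] algebra_simps)
  also have "(\<Sum>k = 0..m. H k * t ^ Suc k) =
      2 * s * r * t * Qfun n m t r - 2 * r * t * dQfun n m t r"
    unfolding H_def dQfun_def Qfun_def R_def dR_def sum_distrib_left
    by (simp add: sum_subtractf[symmetric] algebra_simps)
  finally show ?thesis unfolding s_def by (simp add: power2_eq_square algebra_simps)
qed

section \<open>Iterating the Euler operator on the Poisson kernel\<close>

lemma poisson_base_pos:
  fixes r t :: real
  assumes "0 < r" "r < 1" "t \<le> 1"
  shows "1 - 2 * r * t + r\<^sup>2 > 0"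
proof -
  have "0 < (1 - r)\<^sup>2" using assms by simp
  also have "\<dots> \<le> 1 - 2 * r * t + r\<^sup>2"
    using mult_left_mono[of t 1 "2 * r"] assms by (simp add: power2_eq_square algebra_simps)
  finally show ?thesis .
qed

text \<open>The first application is separate because \<open>(1 - r\<^sup>2) B\<^sup>-\<^sup>\<lambda>\<^sup>-\<^sup>1\<close> is not of the form \<open>r Q B\<^sup>-\<^sup>s\<close>: its
  numerator has no factor \<open>r\<close>. The operator \<open>r \<partial>\<^sub>r\<close> supplies this factor.\<close>

lemma euler_op_poisson:
  fixes r t :: real
  assumes "1 - 2 * r * t + r\<^sup>2 > 0"
  shows "euler_op (\<lambda>x. C * ((1 - x\<^sup>2) / (1 - 2 * x * t + x\<^sup>2) powr ((real n + 1) / 2))) r =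
    C * (r * Qfun n 1 t r) / (1 - 2 * r * t + r\<^sup>2) powr (lam n + real 1 + 1)"
proof -
  define B where "B = 1 - 2 * r * t + r\<^sup>2"
  define s where "s = (real n + 1) / 2"
  have B: "B > 0" using assms by (simp add: B_def)
  have P: "B powr (lam n + real 1 + 1) = B powr s * B"
  proof -
    have "lam n + real 1 + 1 = s + 1" by (simp add: lam_def s_def field_simps)
    then show ?thesis using B by (simp only: powr_add) simp
  qed
  have "((\<lambda>x. C * ((1 - x\<^sup>2) / (1 - 2 * x * t + x\<^sup>2) powr s)) has_field_derivative
     C * ((- 2 * r * B powr s - (1 - r\<^sup>2) * (s * B powr (s - 1) * (2 * r - 2 * t))) / (B powr s)\<^sup>2)) (at r)"
    unfolding B_def using assms
    by (auto intro!: derivative_eq_intros simp: power2_eq_square powr_diff field_simps)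
  then have "euler_op (\<lambda>x. C * ((1 - x\<^sup>2) / (1 - 2 * x * t + x\<^sup>2) powr s)) r =
     r * (C * ((- 2 * r * B powr s - (1 - r\<^sup>2) * (s * B powr (s - 1) * (2 * r - 2 * t))) / (B powr s)\<^sup>2))"
    by (simp add: euler_op_def DERIV_imp_deriv)
  also have "\<dots> = C * (r * (- 2 * r * B - (1 - r\<^sup>2) * (s * (2 * r - 2 * t)))) / (B powr s * B)"
    using B by (simp add: powr_diff field_simps power2_eq_square)
  also have "- 2 * r * B - (1 - r\<^sup>2) * (s * (2 * r - 2 * t)) = Qfun n 1 t r"
    unfolding Qfun_1 B_def s_def
    by (simp add: field_simps power2_eq_square power3_eq_cube)
  finally show ?thesis using P unfolding s_def B_def by simp
qed

lemma euler_op_step: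
  fixes r t :: real
  assumes "m \<ge> 1" and "1 - 2 * r * t + r\<^sup>2 > 0"
  shows "euler_op (\<lambda>x. C * (x * Qfun n m t x) / (1 - 2 * x * t + x\<^sup>2) powr (lam n + real m + 1)) r =
    C * (r * Qfun n (Suc m) t r) / (1 - 2 * r * t + r\<^sup>2) powr (lam n + real (Suc m) + 1)"
proof -
  define B where "B = 1 - 2 * r * t + r\<^sup>2"
  define s where "s = lam n + real m + 1"
  have B: "B > 0" using assms by (simp add: B_def)
  have P: "B powr (lam n + real (Suc m) + 1) = B powr s * B"
    using B powr_add[of B s 1] by (simp add: s_def algebra_simps)
  have D: "((\<lambda>x. (1 - 2 * x * t + x\<^sup>2) powr s) has_field_derivative
      s * B powr (s - 1) * (2 * r - 2 * t)) (at r)"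
    unfolding B_def using assms
    by (auto intro!: derivative_eq_intros simp: power2_eq_square powr_diff field_simps)
  have "((\<lambda>x. C * (x * Qfun n m t x) / (1 - 2 * x * t + x\<^sup>2) powr s) has_field_derivative
     (C * dQfun n m t r * B powr s - C * (r * Qfun n m t r) * (s * B powr (s - 1) * (2 * r - 2 * t)))
       / (B powr s * B powr s)) (at r)"
    using DERIV_divide[OF DERIV_cmult[OF has_derivative_mult_Qfun, of C n m t r] D] B
    by (simp add: B_def)
  then have "euler_op (\<lambda>x. C * (x * Qfun n m t x) / (1 - 2 * x * t + x\<^sup>2) powr s) r =
     r * ((C * dQfun n m t r * B powr s - C * (r * Qfun n m t r) * (s * B powr (s - 1) * (2 * r - 2 * t)))
       / (B powr s * B powr s))"
    by (simp add: euler_op_def DERIV_imp_deriv)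
  also have "\<dots> = C * (r * (B * dQfun n m t r - 2 * s * r * (r - t) * Qfun n m t r)) / (B powr s * B)"
    using B by (simp add: powr_diff field_simps)
  also have "B * dQfun n m t r - 2 * s * r * (r - t) * Qfun n m t r = Qfun n (Suc m) t r"
    unfolding Qfun_Suc[OF assms(1)] B_def s_def ..
  finally show ?thesis using P unfolding s_def B_def by simp
qed

lemma euler_op_cong:
  assumes "open S" and "x \<in> S" and "\<And>z. z \<in> S \<Longrightarrow> f z = g z"
  shows "euler_op f x = euler_op g x"
proof -
  have "eventually (\<lambda>z. f z = g z) (nhds x)"
    using assms by (auto simp: eventually_nhds)
  then show ?thesis by (simp add: euler_op_def deriv_cong_ev)
qed

text \<open>The induction needs the formula on a whole neighbourhood of \<open>r\<close>, since the next step
  differentiates it.\<close>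

lemma euler_op_power_poisson:
  fixes r t :: real
  assumes "m \<ge> 1" and "t \<le> 1" and "0 < r" "r < 1"
  shows "(euler_op ^^ m) (\<lambda>x. C * ((1 - x\<^sup>2) / (1 - 2 * x * t + x\<^sup>2) powr ((real n + 1) / 2))) r =
    C * (r * Qfun n m t r) / (1 - 2 * r * t + r\<^sup>2) powr (lam n + real m + 1)"
  using assms(1,3,4)
proof (induction m arbitrary: r rule: dec_induct)
  case base
  then show ?case
    using euler_op_poisson[OF poisson_base_pos] assms(2) by simp
next
  case (step m)
  have "(euler_op ^^ Suc m)
      (\<lambda>x. C * ((1 - x\<^sup>2) / (1 - 2 * x * t + x\<^sup>2) powr ((real n + 1) / 2))) r =
    euler_op (\<lambda>x. C * (x * Qfun n m t x) / (1 - 2 * x * t + x\<^sup>2) powr (lam n + real m + 1)) r"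
    unfolding funpow.simps o_apply
    by (rule euler_op_cong[of "{0<..<1}"]) (use step in auto)
  also have "\<dots> = C * (r * Qfun n (Suc m) t r) /
      (1 - 2 * r * t + r\<^sup>2) powr (lam n + real (Suc m) + 1)"
    using step assms(2) by (intro euler_op_step poisson_base_pos) auto
  finally show ?case .
qed

(* "Polynomial of degree 2m-k+1" is a bound on the degree, attained when the top coefficient
   is nonzero: for n = 3 the given initial value a_1^{1,1} = -(n-3) vanishes, so R_1^1 = 4. *)
theorem proposition5p1:
  fixes n m :: nat and a r :: real
  assumes "n \<ge> 2" and "CARD('n::finite) = n"
    and "a > 0" and "r = exp (- a)" and "m \<ge> 1"
  shows "(\<forall>k\<le>m. degree (Rpoly n m k) \<le> 2 * m - k + 1 \<and>
            (acoeff n m k ((2 * m - k + 1) div 2) \<noteq> 0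
               \<longrightarrow> degree (Rpoly n m k) = 2 * m - k + 1)) \<and>
         (\<forall>(y :: real \<times> (real ^ 'n)) \<theta> :: real.
            y \<in> sphere 0 1 \<longrightarrow> cos \<theta> = north_pole \<bullet> y \<longrightarrow>
            poisson_wavelet m a y =
              a ^ m / sphere_area n * Dfun (lam n + real m + 1) r \<theta> *
              (\<Sum>k = 0..m. poly (Rpoly n m k) r * cos \<theta> ^ k))"
proof (intro conjI allI impI)
  fix k assume "k \<le> m"
  then show "degree (Rpoly n m k) \<le> 2 * m - k + 1" by (rule degree_Rpoly_le)
next
  fix k assume "k \<le> m" "acoeff n m k ((2 * m - k + 1) div 2) \<noteq> 0"
  then show "degree (Rpoly n m k) = 2 * m - k + 1" by (rule degree_Rpoly_eq)
next
  fix y :: "real \<times> (real ^ 'n)" and \<theta> :: real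
  assume \<theta>: "cos \<theta> = north_pole \<bullet> y"
  have kernel: "(\<lambda>x. poisson_kernel x y) = (\<lambda>x. 1 / sphere_area n *
      ((1 - x\<^sup>2) / (1 - 2 * x * cos \<theta> + x\<^sup>2) powr ((real n + 1) / 2)))"
    by (simp add: poisson_kernel_def assms(2) \<theta>)
  have "0 < r" "r < 1" using assms by auto
  then show "poisson_wavelet m a y =
      a ^ m / sphere_area n * Dfun (lam n + real m + 1) r \<theta> *
      (\<Sum>k = 0..m. poly (Rpoly n m k) r * cos \<theta> ^ k)"
    unfolding poisson_wavelet_def kernel assms(4)[symmetric] Dfun_def Qfun_def[symmetric]
    using assms(5) by (subst euler_op_power_poisson) simp_all
qed

end
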